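(* Let $(X,p_\theta,\theta)$ be a $0$-complete partial extended $b$-metric space such that $p_\theta$ is a continuous functional. Let $T:X\to X$ be a self-mapping and let $k\in[0,1)$ be such that $$p_\theta(Tx,Ty)\le k\,p_\theta(x,y)\qquad\text{for all }x,y\in X.$$ Suppose that for each $x_0\in X$, setting $x_n=T^n x_0$, one has $$\lim_{n,m\to\infty}\theta(x_n,x_m)<\frac1k .$$ Then $T$ has a unique fixed point $u\in X$. Moreover, for each $y\in X$, $T^n y\to u$ as $n\to\infty$.
   Context: Let $X$ be a non-empty set and $\theta:X\times X\to[1,\infty)$. A function $p_\theta:X\times X\to[0,\infty)$ is a partial extended $b$-metric on $X$ (and $(X,p_\theta,\theta)$ is a partial extended $b$-metric space) if for all $x,y,z\in X$: (1) $p_\theta(x,x)=p_\theta(x,y)=p_\theta(y,y)$ if and only if $x=y$; (2) $p_\theta(x,x)\le p_\theta(x,y)$; (3) $p_\theta(x,y)=p_\theta(y,x)$; (4) $p_\theta(x,z)\le\theta(x,z)\,[p_\theta(x,y)+p_\theta(y,z)]-p_\theta(y,y)$. A sequence $\{x_n\}$ in $X$ converges to $x\in X$ (written $x_n\to x$) if $\lim_{n\to\infty}p_\theta(x_n,x)=p_\theta(x,x)$. A sequence $\{x_n\}$ in $X$ is $0$-Cauchy if $\lim_{n,m\to\infty}p_\theta(x_n,x_m)=0$. The space is $0$-complete if for each $0$-Cauchy sequence $\{x_n\}$ in $X$ there exists $x\in X$ such that $\lim_{n,m\to\infty}p_\theta(x_n,x_m)=\lim_{n\to\infty}p_\theta(x_n,x)=p_\theta(x,x)=0$.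 "$p_\theta$ is a continuous functional" means: whenever $x_n\to x$ and $y_n\to y$ in $X$, one has $p_\theta(x_n,y_n)\to p_\theta(x,y)$. When $k=0$, $\frac1k$ is read as $+\infty$. The hypothesis on $\lim_{n,m\to\infty}\theta(x_n,x_m)$ includes the existence of this double limit. *)

theory Defs
  imports "HOL-Library.Extended_Real"
begin

text \<open>The underlying space is a carrier set \<open>X\<close>; the functions \<open>\<theta>\<close> and \<open>p\<close> are total on the
  ambient type and only constrained on \<open>X\<close>.\<close>

locale partial_extended_b_metric =
  fixes X :: "'a set" and p :: "'a \<Rightarrow> 'a \<Rightarrow> real" and \<theta> :: "'a \<Rightarrow> 'a \<Rightarrow> real"
  assumes nonempty: "X \<noteq> {}"
    and theta_ge_1: "\<And>x y. x \<in> X \<Longrightarrow> y \<in> X \<Longrightarrow> 1 \<le> \<theta> x y"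
    and nonneg: "\<And>x y. x \<in> X \<Longrightarrow> y \<in> X \<Longrightarrow> 0 \<le> p x y"
    and eq_iff: "\<And>x y. x \<in> X \<Longrightarrow> y \<in> X \<Longrightarrow> (p x x = p x y \<and> p x y = p y y) \<longleftrightarrow> x = y"
    and small_self: "\<And>x y. x \<in> X \<Longrightarrow> y \<in> X \<Longrightarrow> p x x \<le> p x y"
    and sym: "\<And>x y. x \<in> X \<Longrightarrow> y \<in> X \<Longrightarrow> p x y = p y x"
    and triangle: "\<And>x y z. x \<in> X \<Longrightarrow> y \<in> X \<Longrightarrow> z \<in> X \<Longrightarrow>
      p x z \<le> \<theta> x z * (p x y + p y z) - p y y"

definition pm_converges :: "'a set \<Rightarrow> ('a \<Rightarrow> 'a \<Rightarrow> real) \<Rightarrow> (nat \<Rightarrow> 'a) \<Rightarrow> 'a \<Rightarrow> bool" where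
  "pm_converges X p s x \<longleftrightarrow> range s \<subseteq> X \<and> x \<in> X \<and> (\<lambda>n. p (s n) x) \<longlonglongrightarrow> p x x"

text \<open>A double limit as \<open>n, m\<close> tend to infinity independently is a limit along
  \<open>sequentially \<times>\<^sub>F sequentially\<close>.\<close>

definition zero_Cauchy :: "'a set \<Rightarrow> ('a \<Rightarrow> 'a \<Rightarrow> real) \<Rightarrow> (nat \<Rightarrow> 'a) \<Rightarrow> bool" where
  "zero_Cauchy X p s \<longleftrightarrow> range s \<subseteq> X \<and>
     ((\<lambda>(n, m). p (s n) (s m)) \<longlongrightarrow> 0) (sequentially \<times>\<^sub>F sequentially)"

definition zero_complete :: "'a set \<Rightarrow> ('a \<Rightarrow> 'a \<Rightarrow> real) \<Rightarrow> bool" where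
  "zero_complete X p \<longleftrightarrow> (\<forall>s. zero_Cauchy X p s \<longrightarrow>
     (\<exists>x\<in>X. ((\<lambda>(n, m). p (s n) (s m)) \<longlongrightarrow> 0) (sequentially \<times>\<^sub>F sequentially) \<and>
            (\<lambda>n. p (s n) x) \<longlonglongrightarrow> 0 \<and> p x x = 0))"

definition continuous_functional :: "'a set \<Rightarrow> ('a \<Rightarrow> 'a \<Rightarrow> real) \<Rightarrow> bool" where
  "continuous_functional X p \<longleftrightarrow> (\<forall>s t x y.
     pm_converges X p s x \<longrightarrow> pm_converges X p t y \<longrightarrow> (\<lambda>n. p (s n) (t n)) \<longlonglongrightarrow> p x y)"

text \<open>Bounds of the form \<open>L < 1/k\<close> are stated in the extended reals, where \<open>1/0 = \<infinity>\<close>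
  (over the reals it would be \<open>0\<close>).\<close>

lemma ereal_one_div_zero: "1 / ereal 0 = \<infinity>"
  by simp

end

theory Submission
  imports Defs
begin

text \<open>
  The proof is Banach's argument; the only difficulty is that the factor \<open>\<theta>\<close> in the triangle
  inequality accumulates when the inequality is iterated along the orbit \<open>s n = (T ^^ n) x\<^sub>0\<close>.
  The hypothesis on the double limit supplies a bound \<open>M\<close> with \<open>k * M < 1\<close> for \<open>\<theta>\<close> on a tail of
  the orbit, and this bound is exactly what is needed: splitting off one step at a time and
  contracting the remainder,
  \[ p (s_n, s_{n+j+1}) \le M (p (s_n, s_{n+1}) + p (s_{n+1}, s_{n+j+1}))
       \le M p (s_n, s_{n+1}) + k M p (s_n, s_{n+j}), \]
  so the numbers \<open>p (s n) (s (n + j))\<close> obey, for fixed \<open>n\<close>, an affine recursion of ratio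
  \<open>k * M < 1\<close>.  They are therefore bounded uniformly in \<open>j\<close> by a multiple of
  \<open>p (s n) (s (Suc n)) \<le> k ^ n * p (s 0) (s 1)\<close> (\<open>distance_along_tail_le\<close>), which makes the orbit
  0-Cauchy (\<open>contractive_sequence_zero_Cauchy\<close>).

  The limit \<open>u\<close> of one orbit satisfies \<open>p u u = 0\<close>.  Its image \<open>T u\<close> is at distance \<open>0\<close> from \<open>u\<close>
  by a single use of the triangle inequality with the fixed factor \<open>\<theta> u (T u)\<close>
  (\<open>limit_of_orbit_is_fixed\<close>).  Once a fixed point with \<open>p u u = 0\<close> is known, the contraction
  alone gives \<open>p ((T ^^ n) y) u \<le> k ^ n * p y u\<close>, hence convergence of every orbit.
\<close>

context partial_extended_b_metric
begin

text \<open>Vanishing distance forces vanishing self-distances, so it separates points although \<open>p x x\<close>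
  may be positive in general.\<close>

lemma zero_distance_imp_eq:
  assumes "x \<in> X" "y \<in> X" "p x y = 0"
  shows "x = y"
proof -
  have "p x x = 0" "p y y = 0"
    using small_self[of x y] small_self[of y x] nonneg[of x x] nonneg[of y y] sym[of x y] assms
    by auto
  then show ?thesis
    using eq_iff[of x y] assms by simp
qed

lemma triangle_weak:
  assumes "x \<in> X" "y \<in> X" "z \<in> X"
  shows "p x z \<le> \<theta> x z * (p x y + p y z)"
  using triangle[OF assms] nonneg[of y y] assms by auto

lemma consecutive_distance_le:
  assumes "0 \<le> k" and contr: "\<And>i j. p (s (Suc i)) (s (Suc j)) \<le> k * p (s i) (s j)"
  shows "p (s n) (s (Suc n)) \<le> k ^ n * p (s 0) (s 1)"
proof (induction n)
  case (Suc n)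
  have "p (s (Suc n)) (s (Suc (Suc n))) \<le> k * p (s n) (s (Suc n))"
    by (rule contr)
  also have "\<dots> \<le> k * (k ^ n * p (s 0) (s 1))"
    using Suc \<open>0 \<le> k\<close> by (rule mult_left_mono)
  finally show ?case by (simp add: mult_ac)
qed simp

text \<open>The bound \<open>M / (1 - k * M) * p (s n) (s (Suc n))\<close> is the fixed point of the affine recursion
  \<open>b \<mapsto> M * p (s n) (s (Suc n)) + k * M * b\<close> satisfied by \<open>p (s n) (s (n + j))\<close> as \<open>j\<close> grows; a
  value below it stays below it.\<close>

lemma distance_along_tail_le:
  assumes s: "range s \<subseteq> X" and "0 \<le> k" and kM: "k * M < 1"
    and contr: "\<And>i j. p (s (Suc i)) (s (Suc j)) \<le> k * p (s i) (s j)"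
    and theta: "\<And>m. m \<ge> n \<Longrightarrow> \<theta> (s n) (s m) \<le> M"
  shows "p (s n) (s (n + j)) \<le> M / (1 - k * M) * p (s n) (s (Suc n))"
proof -
  have sX: "s i \<in> X" for i using s by auto
  have M: "1 \<le> M" using theta_ge_1[OF sX sX, of n n] theta[of n] by simp
  define a where "a = p (s n) (s (Suc n))"
  define B where "B = M / (1 - k * M) * a"
  have a: "0 \<le> a" unfolding a_def by (rule nonneg[OF sX sX])
  have B_fixed: "M * a + k * M * B = B"
    using kM by (simp add: B_def field_simps)
  have "p (s n) (s (n + j)) \<le> B"
  proof (induction j)
    case 0
    have "1 - k * M \<le> M" using M mult_nonneg_nonneg[of k M] \<open>0 \<le> k\<close> by linarith
    then have "1 \<le> M / (1 - k * M)" using kM by (simp add: field_simps)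
    then have "1 * a \<le> B" unfolding B_def using a by (rule mult_right_mono)
    moreover have "p (s n) (s n) \<le> a"
      unfolding a_def by (rule small_self[OF sX sX])
    ultimately show ?case by simp
  next
    case (Suc j)
    have "p (s n) (s (n + Suc j))
        \<le> \<theta> (s n) (s (n + Suc j)) * (a + p (s (Suc n)) (s (n + Suc j)))"
      unfolding a_def by (rule triangle_weak[OF sX sX sX])
    also have "\<dots> \<le> M * (a + p (s (Suc n)) (s (n + Suc j)))"
      using theta[of "n + Suc j"] a nonneg[OF sX sX, of "Suc n" "n + Suc j"]
      by (intro mult_right_mono) auto
    also have "\<dots> \<le> M * (a + k * B)"
    proof -
      have "p (s (Suc n)) (s (n + Suc j)) \<le> k * p (s n) (s (n + j))"
        using contr[of n "n + j"] by simp
      also have "\<dots> \<le> k * B" using Suc \<open>0 \<le> k\<close> by (rule mult_left_mono)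
      finally show ?thesis using M by (intro mult_left_mono) auto
    qed
    also have "\<dots> = B" using B_fixed by (simp add: algebra_simps)
    finally show ?case .
  qed
  then show ?thesis by (simp add: B_def a_def)
qed

lemma contractive_sequence_zero_Cauchy:
  assumes s: "range s \<subseteq> X" and k: "0 \<le> k" "k < 1" and kM: "k * M < 1"
    and contr: "\<And>i j. p (s (Suc i)) (s (Suc j)) \<le> k * p (s i) (s j)"
    and theta: "\<forall>\<^sub>F (n, m) in sequentially \<times>\<^sub>F sequentially. \<theta> (s n) (s m) \<le> M"
  shows "zero_Cauchy X p s"
proof -
  have sX: "s i \<in> X" for i using s by auto
  obtain N where N: "\<And>n m. n \<ge> N \<Longrightarrow> m \<ge> N \<Longrightarrow> \<theta> (s n) (s m) \<le> M"
    using theta unfolding eventually_prod_sequentially by auto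
  have M: "1 \<le> M" using theta_ge_1[OF sX sX, of N N] N[of N N] by simp
  define C where "C = M / (1 - k * M) * p (s 0) (s 1)"
  have ordered: "p (s n) (s m) \<le> C * k ^ n" if "N \<le> n" "n \<le> m" for n m
  proof -
    have "p (s n) (s (n + (m - n))) \<le> M / (1 - k * M) * p (s n) (s (Suc n))"
      by (rule distance_along_tail_le[OF s k(1) kM contr]) (use N that in auto)
    also have "\<dots> \<le> M / (1 - k * M) * (k ^ n * p (s 0) (s 1))"
      using M kM consecutive_distance_le[of k s n, OF k(1) contr]
      by (intro mult_left_mono) auto
    finally show ?thesis using that by (simp add: C_def mult_ac)
  qed
  have "(\<lambda>n. C * k ^ n) \<longlonglongrightarrow> 0"
    using LIMSEQ_realpow_zero[OF k] by (rule tendsto_mult_right_zero)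
  have "((\<lambda>(n, m). p (s n) (s m)) \<longlongrightarrow> 0) (sequentially \<times>\<^sub>F sequentially)"
  proof (rule tendstoI)
    fix e :: real assume "0 < e"
    then have "\<forall>\<^sub>F n in sequentially. C * k ^ n < e"
      using order_tendstoD(2)[OF \<open>(\<lambda>n. C * k ^ n) \<longlonglongrightarrow> 0\<close>] by blast
    then obtain K where K: "\<And>n. n \<ge> K \<Longrightarrow> C * k ^ n < e"
      unfolding eventually_sequentially by blast
    have "p (s n) (s m) < e" if "n \<ge> max N K" "m \<ge> max N K" for n m
      using ordered[of n m] ordered[of m n] K[of n] K[of m] sym[OF sX sX, of n m] that
      by (cases "n \<le> m") auto
    then show "\<forall>\<^sub>F nm in sequentially \<times>\<^sub>F sequentially.
        dist (case nm of (n, m) \<Rightarrow> p (s n) (s m)) 0 < e"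
      unfolding eventually_prod_sequentially
      by (intro exI[of _ "max N K"]) (auto simp: abs_of_nonneg[OF nonneg[OF sX sX]])
  qed
  then show ?thesis using s by (simp add: zero_Cauchy_def)
qed

text \<open>Both terms of \<open>p u (T u) \<le> \<theta> u (T u) * (p u (s (Suc n)) + k * p (s n) u)\<close> on the right tend
  to \<open>0\<close> with \<open>n\<close>, and the factor \<open>\<theta> u (T u)\<close> stays constant because the orbit enters the triangle
  inequality only as its middle point.\<close>

lemma limit_of_orbit_is_fixed:
  assumes T: "T ` X \<subseteq> X"
    and contr: "\<And>x y. x \<in> X \<Longrightarrow> y \<in> X \<Longrightarrow> p (T x) (T y) \<le> k * p x y"
    and s: "range s \<subseteq> X" "\<And>n. s (Suc n) = T (s n)"
    and u: "u \<in> X" and lim: "(\<lambda>n. p (s n) u) \<longlonglongrightarrow> 0"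
  shows "T u = u"
proof -
  have sX: "s i \<in> X" for i using s(1) by auto
  have Tu: "T u \<in> X" using T u by auto
  have "p u (T u) \<le> \<theta> u (T u) * (p (s (Suc n)) u + k * p (s n) u)" for n
  proof -
    have "p u (T u) \<le> \<theta> u (T u) * (p u (s (Suc n)) + p (s (Suc n)) (T u))"
      by (rule triangle_weak[OF u sX Tu])
    also have "\<dots> \<le> \<theta> u (T u) * (p (s (Suc n)) u + k * p (s n) u)"
      using contr[OF sX u, of n] sym[OF u sX, of "Suc n"] theta_ge_1[OF u Tu]
      by (intro mult_left_mono) (auto simp: s(2))
    finally show ?thesis .
  qed
  moreover have "(\<lambda>n. \<theta> u (T u) * (p (s (Suc n)) u + k * p (s n) u)) \<longlonglongrightarrow> 0"
    using lim LIMSEQ_Suc[OF lim] by (auto intro!: tendsto_eq_intros)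
  ultimately have "p u (T u) \<le> 0"
    by (intro LIMSEQ_le_const) auto
  then show ?thesis
    using zero_distance_imp_eq[OF u Tu] nonneg[OF u Tu] by simp
qed

end

text \<open>Strictness of the inequality, or \<open>1 / 0 = \<infinity>\<close> in the case \<open>k = 0\<close>, leaves room for a
  number \<open>M\<close> above \<open>L\<close>, which then bounds a function
  tending to \<open>L\<close> eventually and not merely in the limit.\<close>

lemma room_below_reciprocal:
  fixes k L :: real
  assumes "0 \<le> k" and L: "ereal L < 1 / ereal k"
  obtains M where "L < M" "k * M < 1"
proof (cases "k = 0")
  case True
  then show ?thesis using that[of "L + 1"] by simp
next
  case False
  then have "0 < k" using \<open>0 \<le> k\<close> by simp
  then have "L < 1 / k" using L by (simp add: one_ereal_def)
  then obtain M where "L < M" "M < 1 / k" using dense by blast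
  then show ?thesis using that \<open>0 < k\<close> by (simp add: field_simps)
qed

theorem theorem3p9:
  fixes X :: "'a set" and p \<theta> :: "'a \<Rightarrow> 'a \<Rightarrow> real" and T :: "'a \<Rightarrow> 'a" and k :: real
  assumes "partial_extended_b_metric X p \<theta>"
    and "zero_complete X p"
    and "continuous_functional X p"
    and "T ` X \<subseteq> X"
    and "0 \<le> k" and "k < 1"
    and "\<forall>x\<in>X. \<forall>y\<in>X. p (T x) (T y) \<le> k * p x y"
    and "\<forall>x0\<in>X. \<exists>L::real.
      ((\<lambda>(n, m). \<theta> ((T ^^ n) x0) ((T ^^ m) x0)) \<longlongrightarrow> L) (sequentially \<times>\<^sub>F sequentially)
      \<and> ereal L < 1 / ereal k"
  shows "\<exists>u\<in>X. T u = u \<and> (\<forall>v\<in>X. T v = v \<longrightarrow> v = u)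
    \<and> (\<forall>y\<in>X. pm_converges X p (\<lambda>n. (T ^^ n) y) u)"
proof -
  interpret partial_extended_b_metric X p \<theta> by fact
  have contr: "p (T x) (T y) \<le> k * p x y" if "x \<in> X" "y \<in> X" for x y
    using assms(7) that by blast
  have orbit: "(T ^^ n) y \<in> X" if "y \<in> X" for n y
    using that assms(4) by (induction n) auto

  obtain x0 where x0: "x0 \<in> X" using nonempty by blast
  define s where "s n = (T ^^ n) x0" for n
  have s: "range s \<subseteq> X" using orbit[OF x0] by (auto simp: s_def)
  obtain L where L: "((\<lambda>(n, m). \<theta> (s n) (s m)) \<longlongrightarrow> L) (sequentially \<times>\<^sub>F sequentially)"
      "ereal L < 1 / ereal k"
    using assms(8) x0 unfolding s_def by blast
  obtain M where M: "L < M" "k * M < 1"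
    using room_below_reciprocal[OF assms(5) L(2)] .
  have "\<forall>\<^sub>F (n, m) in sequentially \<times>\<^sub>F sequentially. \<theta> (s n) (s m) \<le> M"
    using order_tendstoD(2)[OF L(1) M(1)] by (rule eventually_mono) auto
  moreover have "p (s (Suc i)) (s (Suc j)) \<le> k * p (s i) (s j)" for i j
    using contr[OF orbit[OF x0] orbit[OF x0], of i j] by (simp add: s_def)
  ultimately have "zero_Cauchy X p s"
    using contractive_sequence_zero_Cauchy[OF s assms(5,6) M(2)] by blast
  then obtain u where u: "u \<in> X" "(\<lambda>n. p (s n) u) \<longlonglongrightarrow> 0" "p u u = 0"
    using assms(2) unfolding zero_complete_def by blast
  have fixed: "T u = u"
    by (rule limit_of_orbit_is_fixed[OF assms(4) contr s _ u(1,2)]) (auto simp: s_def)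

  have unique: "v = u" if "v \<in> X" "T v = v" for v
  proof -
    have "p v u \<le> k * p v u" using contr[OF that(1) u(1)] that(2) fixed by simp
    then have "(1 - k) * p v u \<le> 0" by (simp add: algebra_simps)
    then have "p v u = 0"
      using nonneg[OF that(1) u(1)] assms(6) by (simp add: mult_le_0_iff)
    then show ?thesis using zero_distance_imp_eq that u by blast
  qed

  have "pm_converges X p (\<lambda>n. (T ^^ n) y) u" if y: "y \<in> X" for y
  proof -
    have bound: "p ((T ^^ n) y) u \<le> k ^ n * p y u" for n
    proof (induction n)
      case (Suc n)
      have "p ((T ^^ Suc n) y) u \<le> k * p ((T ^^ n) y) u"
        using contr[OF orbit[OF y] u(1), of n] fixed by simp
      also have "\<dots> \<le> k * (k ^ n * p y u)"
        using Suc assms(5) by (rule mult_left_mono)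
      finally show ?case by (simp add: mult_ac)
    qed simp
    have "(\<lambda>n. p ((T ^^ n) y) u) \<longlonglongrightarrow> 0"
    proof (rule tendsto_sandwich[OF _ _ tendsto_const])
      show "(\<lambda>n. k ^ n * p y u) \<longlonglongrightarrow> 0"
        using LIMSEQ_realpow_zero[OF assms(5,6)] by (rule tendsto_mult_left_zero)
    qed (use bound nonneg[OF orbit[OF y] u(1)] in auto)
    then show ?thesis
      using u orbit[OF y] by (auto simp: pm_converges_def)
  qed
  then show ?thesis using u(1) fixed unique by blast
qed

end
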